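(* Assume that the objective in the primal problem $\min_{x\in Q\subseteq E}\{f(x):Ax=b\}$ is $\gamma$-strongly convex and that the dual solution $\lambda^*$ satisfies $\|\lambda^*\|_2\le R$. Then, for $k\ge1$, the points $\hat x_k,\eta_k$ in the Adaptive Primal-Dual Accelerated Gradient Descent (APDAGD, described in the context) satisfy $$f(\hat x_k)-f^*\le f(\hat x_k)+\varphi(\eta_k)\le\frac{16\|A\|_{E\to H}^2R^2}{\gamma k^2},$$ $$\|A\hat x_k-b\|_2\le\frac{16\|A\|_{E\to H}^2R}{\gamma k^2},$$ $$\|\hat x_k-x^*\|_E\le\frac8k\frac{\|A\|_{E\to H}R}\gamma,$$ where $x^*$ and $f^*$ are respectively an optimal solution and the optimal value of the primal problem. Moreover, the stopping criterion of APDAGD is correctly defined, i.e. for any $\varepsilon_f,\varepsilon_{eq}>0$ it is fulfilled after finitely many iterations.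
   Context: $E$, $H$ are finite-dimensional real vector spaces, $\|\cdot\|_E$ a norm on $E$, $H$ with the Euclidean norm $\|\cdot\|_2$; $Q\subseteq E$ a simple closed convex set, $A:E\to H$ linear, $b\in H$, and $\|A\|_{E\to H}=\max\{\langle u,Ax\rangle:\|x\|_E=1,\|u\|_{H,*}=1\}$. $f$ is $\gamma$-strongly convex on $Q$ w.r.t. $\|\cdot\|_E$: $f(y)\ge f(x)+\langle\nabla f(x),y-x\rangle+\frac\gamma2\|x-y\|_E^2$ for any subgradient $\nabla f(x)$. Dual problem (as a minimization problem): $\min_{\lambda\in H^*}\{\varphi(\lambda):=\langle\lambda,b\rangle+\max_{x\in Q}(-f(x)-\langle A^T\lambda,x\rangle)\}$. Here $\nabla\varphi(\lambda)=b-Ax(\lambda)$, $x(\lambda)=\arg\max_{x\in Q}(-f(x)-\langle A^T\lambda,x\rangle)$, and $\nabla\varphi$ is Lipschitz with constant $L\le\|A\|_{E\to H}^2/\gamma$. It is assumed that the dual problem has a solution; $\lambda^*$ is the solution of minimum $\|\cdot\|_2$-norm. APDAGD: input $\varepsilon_f,\varepsilon_{eq}>0$, $L_0$ with $0<L_0<2L$. Set $k=0$, $M_{-1}=L_0$, $\beta_0=0$, $\eta_0=\zeta_0=\lambda_0=0$. Main iteration $k$: for $i_k=0,1,2,\dots$ (line search) set $M_k=2^{i_k-1}M_{k-1}$; find $\alpha_{k+1}>0$ with $\beta_{k+1}:=\beta_k+\alpha_{k+1}=M_k\alpha_{k+1}^2$; $\tau_k=\alpha_{k+1}/\beta_{k+1}$;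 $\lambda_{k+1}=\tau_k\zeta_k+(1-\tau_k)\eta_k$; $\zeta_{k+1}=\zeta_k-\alpha_{k+1}\nabla\varphi(\lambda_{k+1})$; $\eta_{k+1}=\tau_k\zeta_{k+1}+(1-\tau_k)\eta_k$; until $$\varphi(\eta_{k+1})\le\varphi(\lambda_{k+1})+\langle\nabla\varphi(\lambda_{k+1}),\eta_{k+1}-\lambda_{k+1}\rangle+\frac{M_k}2\|\eta_{k+1}-\lambda_{k+1}\|_2^2.$$ Then $\hat x_{k+1}=\tau_kx(\lambda_{k+1})+(1-\tau_k)\hat x_k$ (note $\tau_0=1$), $k:=k+1$. Stopping criterion: $f(\hat x_{k+1})+\varphi(\eta_{k+1})\le\varepsilon_f$ and $\|A\hat x_{k+1}-b\|_2\le\varepsilon_{eq}$. Output $\hat x_{k+1},\eta_{k+1}$. *)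

theory Defs
  imports "HOL-Analysis.Analysis"
begin

(* The norm of E is the type-class norm of 'e (arbitrary, not Euclidean).  H is a Euclidean space,
   identified with its dual through the inner product; in particular <A^T l, x> = <l, A x>
   is written  l \<bullet> A x. *)

definition finite_dim :: "'e::real_vector itself \<Rightarrow> bool" where
  "finite_dim _ \<longleftrightarrow> (\<exists>B::'e set. finite B \<and> span B = UNIV)"

(* A subgradient is an element of the dual space of E, i.e. a linear functional.  It is taken
   relative to Q, as for the function equal to f on Q and to plus infinity outside. *)
definition subgradient_on ::
    "'e::real_vector set \<Rightarrow> ('e \<Rightarrow> real) \<Rightarrow> 'e \<Rightarrow> ('e \<Rightarrow> real) \<Rightarrow> bool" where
  "subgradient_on Q f x g \<longleftrightarrow> linear g \<and> (\<forall>y\<in>Q. f y \<ge> f x + g (y - x))"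

definition strongly_convex_on ::
    "real \<Rightarrow> 'e::real_normed_vector set \<Rightarrow> ('e \<Rightarrow> real) \<Rightarrow> bool" where
  "strongly_convex_on \<gamma> Q f \<longleftrightarrow> \<gamma> > 0 \<and> convex_on Q f \<and>
     (\<forall>x\<in>Q. \<forall>y\<in>Q. \<forall>g. subgradient_on Q f x g \<longrightarrow>
        f y \<ge> f x + g (y - x) + \<gamma> / 2 * (norm (x - y))\<^sup>2)"

definition feasible :: "('e \<Rightarrow> 'h) \<Rightarrow> 'h \<Rightarrow> 'e set \<Rightarrow> 'e set" where
  "feasible A b Q = {x \<in> Q. A x = b}"

definition primal_value :: "('e \<Rightarrow> real) \<Rightarrow> ('e \<Rightarrow> 'h) \<Rightarrow> 'h \<Rightarrow> 'e set \<Rightarrow> real" where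
  "primal_value f A b Q = (INF x\<in>feasible A b Q. f x)"

definition inner_objective ::
    "('e \<Rightarrow> real) \<Rightarrow> ('e \<Rightarrow> 'h::real_inner) \<Rightarrow> 'h \<Rightarrow> 'e \<Rightarrow> real" where
  "inner_objective f A l x = - f x - l \<bullet> A x"

definition dual_point ::
    "('e \<Rightarrow> real) \<Rightarrow> ('e \<Rightarrow> 'h::real_inner) \<Rightarrow> 'e set \<Rightarrow> 'h \<Rightarrow> 'e" where
  "dual_point f A Q l = arg_max_on (inner_objective f A l) Q"

definition dual_objective ::
    "('e \<Rightarrow> real) \<Rightarrow> ('e \<Rightarrow> 'h::real_inner) \<Rightarrow> 'h \<Rightarrow> 'e set \<Rightarrow> 'h \<Rightarrow> real" where
  "dual_objective f A b Q l = l \<bullet> b + (SUP x\<in>Q. inner_objective f A l x)"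

definition dual_solution ::
    "('e \<Rightarrow> real) \<Rightarrow> ('e \<Rightarrow> 'h::real_inner) \<Rightarrow> 'h \<Rightarrow> 'e set \<Rightarrow> 'h \<Rightarrow> bool" where
  "dual_solution f A b Q l \<longleftrightarrow> is_arg_min (dual_objective f A b Q) (\<lambda>_. True) l"

definition gradient :: "('h::real_inner \<Rightarrow> real) \<Rightarrow> 'h \<Rightarrow> 'h" where
  "gradient F l = (THE D. GDERIV F l :> D)"

(* The state with index k: st_M is M_(k-1), the other components are
   beta_k, zeta_k, eta_k, lambda_k and xhat_k. *)
record ('e, 'h) apdagd_state =
  st_M :: real
  st_beta :: real
  st_zeta :: 'h
  st_eta :: 'h
  st_lam :: 'h
  st_xhat :: 'e

(* The value of xhat_0 is irrelevant, because tau_0 = 1. *)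
definition apdagd_init ::
    "real \<Rightarrow> ('e::real_vector, 'h::real_inner) apdagd_state" where
  "apdagd_init L0 =
     \<lparr>st_M = L0, st_beta = 0, st_zeta = 0, st_eta = 0, st_lam = 0, st_xhat = 0\<rparr>"

definition apdagd_trial ::
    "('e::real_vector \<Rightarrow> real) \<Rightarrow> ('e \<Rightarrow> 'h::real_inner) \<Rightarrow> 'h \<Rightarrow> 'e set \<Rightarrow>
     ('e, 'h) apdagd_state \<Rightarrow> nat \<Rightarrow> ('e, 'h) apdagd_state" where
  "apdagd_trial f A b Q s i =
    (let M = 2 powi (int i - 1) * st_M s;
         \<alpha> = (THE a. a > 0 \<and> st_beta s + a = M * a\<^sup>2);
         \<beta>' = st_beta s + \<alpha>;
         \<tau> = \<alpha> / \<beta>';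
         lam' = \<tau> *\<^sub>R st_zeta s + (1 - \<tau>) *\<^sub>R st_eta s;
         \<zeta>' = st_zeta s - \<alpha> *\<^sub>R gradient (dual_objective f A b Q) lam';
         \<eta>' = \<tau> *\<^sub>R \<zeta>' + (1 - \<tau>) *\<^sub>R st_eta s;
         x' = \<tau> *\<^sub>R dual_point f A Q lam' + (1 - \<tau>) *\<^sub>R st_xhat s
     in \<lparr>st_M = M, st_beta = \<beta>', st_zeta = \<zeta>', st_eta = \<eta>', st_lam = lam', st_xhat = x'\<rparr>)"

definition apdagd_accept ::
    "('e \<Rightarrow> real) \<Rightarrow> ('e \<Rightarrow> 'h::real_inner) \<Rightarrow> 'h \<Rightarrow> 'e set \<Rightarrow>
     ('e, 'h) apdagd_state \<Rightarrow> bool" where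
  "apdagd_accept f A b Q s \<longleftrightarrow>
     dual_objective f A b Q (st_eta s) \<le>
       dual_objective f A b Q (st_lam s)
       + gradient (dual_objective f A b Q) (st_lam s) \<bullet> (st_eta s - st_lam s)
       + st_M s / 2 * (norm (st_eta s - st_lam s))\<^sup>2"

(* The line search returns the first accepted trial.  LEAST is meaningful only if some trial
   is accepted; line_search_ends expresses that. *)
definition line_search_ends ::
    "('e::real_vector \<Rightarrow> real) \<Rightarrow> ('e \<Rightarrow> 'h::real_inner) \<Rightarrow> 'h \<Rightarrow> 'e set \<Rightarrow>
     ('e, 'h) apdagd_state \<Rightarrow> bool" where
  "line_search_ends f A b Q s \<longleftrightarrow> (\<exists>i. apdagd_accept f A b Q (apdagd_trial f A b Q s i))"

definition apdagd_step ::
    "('e::real_vector \<Rightarrow> real) \<Rightarrow> ('e \<Rightarrow> 'h::real_inner) \<Rightarrow> 'h \<Rightarrow> 'e set \<Rightarrow>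
     ('e, 'h) apdagd_state \<Rightarrow> ('e, 'h) apdagd_state" where
  "apdagd_step f A b Q s =
     apdagd_trial f A b Q s (LEAST i. apdagd_accept f A b Q (apdagd_trial f A b Q s i))"

(* The iterates, continued beyond the stopping time. *)
definition apdagd ::
    "('e::real_vector \<Rightarrow> real) \<Rightarrow> ('e \<Rightarrow> 'h::real_inner) \<Rightarrow> 'h \<Rightarrow> 'e set \<Rightarrow>
     real \<Rightarrow> nat \<Rightarrow> ('e, 'h) apdagd_state" where
  "apdagd f A b Q L0 k = (apdagd_step f A b Q ^^ k) (apdagd_init L0)"

definition apdagd_stop ::
    "('e \<Rightarrow> real) \<Rightarrow> ('e \<Rightarrow> 'h::real_inner) \<Rightarrow> 'h \<Rightarrow> 'e set \<Rightarrow>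
     real \<Rightarrow> real \<Rightarrow> ('e, 'h) apdagd_state \<Rightarrow> bool" where
  "apdagd_stop f A b Q \<epsilon>f \<epsilon>eq s \<longleftrightarrow>
     f (st_xhat s) + dual_objective f A b Q (st_eta s) \<le> \<epsilon>f \<and>
     norm (A (st_xhat s) - b) \<le> \<epsilon>eq"

end

theory Submission
  imports Defs
begin

text \<open>
  A maximiser of the inner problem at \<open>l\<close> is a point where minus the adjoint of \<open>A\<close> applied
  to \<open>l\<close> is a subgradient of \<open>f\<close>, so strong convexity bounds the dual objective \<open>\<phi>\<close> between its
  linearisation and that linearisation plus half of \<open>\<kappa> = \<parallel>A\<parallel>\<^sup>2 / \<gamma>\<close> times the squared distance.
  Hence the line search ends with \<open>M \<le> 2 \<kappa>\<close>, which gives \<open>\<beta>\<^sub>k \<ge> k\<^sup>2 / (8 \<kappa>)\<close>.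

  The estimating sequence collapses to two relations between the iterates,
  \<open>\<zeta> = \<beta> (A x - b)\<close> and \<open>\<beta> (\<phi> \<eta> + f x) \<le> - \<parallel>\<zeta>\<parallel>\<^sup>2 / 2\<close>, where \<open>x\<close> is the averaged primal point.
  Together they say \<open>\<phi> \<eta> + f x \<le> - \<beta> \<parallel>A x - b\<parallel>\<^sup>2 / 2\<close>; the left side is at least
  \<open>- R \<parallel>A x - b\<parallel>\<close>, whence \<open>\<parallel>A x - b\<parallel> \<le> 2 R / \<beta>\<close>. The distance to the optimum follows from
  strong convexity at \<open>x(\<lambda>\<^sup>*) = x\<^sup>*\<close>.
\<close>

section \<open>Linear maps on finite-dimensional normed spaces\<close>

text \<open>A ball of radius \<open>d\<close> around \<open>a\<close> misses the closed span.
  Dividing by \<open>t\<close> would turn a too short \<open>t *\<^sub>R a + y\<close> into a point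
  of the span inside that ball. Hence the coordinate along \<open>a\<close> is controlled by the
  norm.\<close>

lemma scale_le_norm_add_span:
  fixes a :: "'e::real_normed_vector"
  assumes "closed (span B)" "a \<notin> span B"
  obtains d where "d > 0" "\<And>t y. y \<in> span B \<Longrightarrow> \<bar>t\<bar> * d \<le> norm (t *\<^sub>R a + y)"
proof -
  from assms obtain d where d: "d > 0" "ball a d \<subseteq> - span B"
    using open_Compl[OF assms(1)] openE[of "- span B" a] by auto
  have "\<bar>t\<bar> * d \<le> norm (t *\<^sub>R a + y)" if y: "y \<in> span B" for t y
  proof (cases "t = 0")
    case False
    have "- (y /\<^sub>R t) \<in> span B" using y by (intro span_neg span_scale)
    with d have "- (y /\<^sub>R t) \<notin> ball a d" by auto
    then have "d \<le> norm (a + y /\<^sub>R t)" by (simp add: dist_norm)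
    then have "\<bar>t\<bar> * d \<le> \<bar>t\<bar> * norm (a + y /\<^sub>R t)" by (intro mult_left_mono) auto
    also have "\<dots> = norm (t *\<^sub>R (a + y /\<^sub>R t))" by simp
    also have "t *\<^sub>R (a + y /\<^sub>R t) = t *\<^sub>R a + y" using False by (simp add: scaleR_add_right)
    finally show ?thesis .
  qed simp
  with d(1) show thesis using that by blast
qed

lemma span_insert_decompose:
  assumes "x \<in> span (insert a B)"
  obtains t y where "y \<in> span B" "x = t *\<^sub>R a + y"
proof -
  from assms obtain k where "x - k *\<^sub>R a \<in> span B" by (auto simp: span_insert)
  then show thesis using that[of "x - k *\<^sub>R a" k] by simp
qed

text \<open>Induction on \<open>B\<close>: along a convergent sequence the coordinates in direction
  \<open>a\<close> are Cauchy by the previous estimate, and removing them leaves a convergent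
  sequence in the smaller span, closed by induction.\<close>

lemma closed_span_finite:
  fixes B :: "'e::real_normed_vector set"
  assumes "finite B"
  shows "closed (span B)"
  using assms
proof (induction B)
  case (insert a B)
  show ?case
  proof (cases "a \<in> span B")
    case True
    then show ?thesis using insert.IH by (simp add: span_redundant)
  next
    case False
    from scale_le_norm_add_span[OF insert.IH False] obtain d where d: "d > 0"
      and le: "\<And>t y. y \<in> span B \<Longrightarrow> \<bar>t\<bar> * d \<le> norm (t *\<^sub>R a + y)" by metis
    show ?thesis unfolding closed_sequential_limits
    proof (intro allI impI, elim conjE)
      fix X l assume X: "\<forall>n. X n \<in> span (insert a B)" "X \<longlonglongrightarrow> l"
      have "\<forall>n. \<exists>t y. y \<in> span B \<and> X n = t *\<^sub>R a + y"
        using X(1) by (meson span_insert_decompose)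
      then obtain T Y where Y: "\<And>n. Y n \<in> span B" and XT: "\<And>n. X n = T n *\<^sub>R a + Y n" by metis
      have diff: "\<bar>T m - T n\<bar> * d \<le> norm (X m - X n)" for m n
        using le[OF span_diff[OF Y[of m] Y[of n]], of "T m - T n"] by (simp add: XT algebra_simps)
      have "Cauchy T"
      proof (rule metric_CauchyI)
        fix e :: real assume "e > 0"
        with d have "e * d > 0" by simp
        with LIMSEQ_imp_Cauchy[OF X(2)] obtain M
          where "\<forall>m\<ge>M. \<forall>n\<ge>M. dist (X m) (X n) < e * d" by (meson metric_CauchyD)
        then have "\<forall>m\<ge>M. \<forall>n\<ge>M. \<bar>T m - T n\<bar> * d < e * d"
          using diff by (metis dist_norm le_less_trans)
        then show "\<exists>M. \<forall>m\<ge>M. \<forall>n\<ge>M. dist (T m) (T n) < e" using d by (auto simp: dist_real_def)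
      qed
      then obtain t where t: "T \<longlonglongrightarrow> t" by (auto simp: Cauchy_convergent_iff convergent_def)
      have "(\<lambda>n. X n - T n *\<^sub>R a) \<longlonglongrightarrow> l - t *\<^sub>R a" by (intro tendsto_intros X t)
      then have "Y \<longlonglongrightarrow> l - t *\<^sub>R a" by (simp add: XT)
      then have "l - t *\<^sub>R a \<in> span B" using insert.IH Y by (meson closed_sequentially)
      then show "l \<in> span (insert a B)" by (auto simp: span_insert)
    qed
  qed
qed simp

text \<open>Splitting off one generator \<open>a\<close>, both the coordinate \<open>t\<close> and
  the remainder \<open>y\<close> are at most a multiple of the norm of the vector. This stands in
  for equivalence of norms, the norm of E being arbitrary.\<close>

lemma linear_bounded_on_span_finite:
  fixes A :: "'e::real_normed_vector \<Rightarrow> 'h::real_normed_vector"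
  assumes "linear A" "finite B"
  shows "\<exists>K\<ge>0. \<forall>x\<in>span B. norm (A x) \<le> norm x * K"
  using assms(2)
proof (induction B)
  case empty
  show ?case using linear_0[OF assms(1)] by auto
next
  case (insert a B)
  show ?case
  proof (cases "a \<in> span B")
    case True
    then show ?thesis using insert.IH by (simp add: span_redundant)
  next
    case False
    from scale_le_norm_add_span[OF closed_span_finite[OF insert.hyps(1)] False] obtain d where d: "d > 0"
      and le: "\<And>t y. y \<in> span B \<Longrightarrow> \<bar>t\<bar> * d \<le> norm (t *\<^sub>R a + y)" by metis
    from insert.IH obtain K where K: "K \<ge> 0" "\<forall>x\<in>span B. norm (A x) \<le> norm x * K" by auto
    define C where "C = norm (A a) / d + (1 + norm a / d) * K"
    have "norm (A x) \<le> norm x * C" if x: "x \<in> span (insert a B)" for x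
    proof -
      from x obtain t y where y: "y \<in> span B" and xt: "x = t *\<^sub>R a + y"
        by (rule span_insert_decompose)
      have t: "\<bar>t\<bar> \<le> norm x / d" using le[OF y, of t] d by (simp add: xt field_simps)
      have "norm y = norm (x - t *\<^sub>R a)" by (simp add: xt)
      also have "\<dots> \<le> norm x + \<bar>t\<bar> * norm a" using norm_triangle_ineq4[of x "t *\<^sub>R a"] by simp
      also have "\<dots> \<le> norm x + norm x / d * norm a" by (intro add_left_mono mult_right_mono t) auto
      finally have ny: "norm y \<le> norm x + norm x / d * norm a" .
      have "norm (A x) = norm (t *\<^sub>R A a + A y)"
        using assms(1) by (simp add: xt linear_add linear_scale)
      also have "\<dots> \<le> \<bar>t\<bar> * norm (A a) + norm (A y)"
        using norm_triangle_ineq[of "t *\<^sub>R A a" "A y"] by simp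
      also have "\<dots> \<le> norm x / d * norm (A a) + norm y * K"
        using K y by (intro add_mono mult_right_mono t) auto
      also have "\<dots> \<le> norm x / d * norm (A a) + (norm x + norm x / d * norm a) * K"
        by (intro add_left_mono mult_right_mono ny K)
      also have "\<dots> = norm x * C" by (simp add: C_def algebra_simps)
      finally show ?thesis .
    qed
    moreover have "C \<ge> 0" using d K by (simp add: C_def)
    ultimately show ?thesis by blast
  qed
qed

lemma finite_dim_linear_imp_bounded_linear:
  fixes A :: "'e::real_normed_vector \<Rightarrow> 'h::real_normed_vector"
  assumes "finite_dim TYPE('e)" "linear A"
  shows "bounded_linear A"
proof -
  from assms(1) obtain B :: "'e set" where B: "finite B" "span B = UNIV"
    by (auto simp: finite_dim_def)
  with linear_bounded_on_span_finite[OF assms(2) B(1)] show ?thesis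
    using assms(2) by (auto simp: bounded_linear_def bounded_linear_axioms_def)
qed

lemma onorm_inner_le:
  assumes "bounded_linear A"
  shows "\<bar>l \<bullet> A x\<bar> \<le> norm l * (onorm A * norm x)"
proof -
  have "\<bar>l \<bullet> A x\<bar> \<le> norm l * norm (A x)" by (rule Cauchy_Schwarz_ineq2)
  also have "\<dots> \<le> norm l * (onorm A * norm x)"
    by (intro mult_left_mono onorm[OF assms]) auto
  finally show ?thesis .
qed

section \<open>The dual objective\<close>

lemma gradient_eq:
  fixes F :: "'h::real_inner \<Rightarrow> real"
  assumes "GDERIV F l :> D"
  shows "gradient F l = D"
  unfolding gradient_def
proof (rule the_equality)
  fix D' assume "GDERIV F l :> D'"
  with assms have "(\<lambda>h. h \<bullet> D') = (\<lambda>h. h \<bullet> D)"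
    unfolding gderiv_def by (rule has_derivative_unique[rotated])
  then have "(D' - D) \<bullet> (D' - D) = 0" by (metis inner_diff_right right_minus_eq)
  then show "D' = D" by simp
qed (rule assms)

lemma GDERIV_if_quadratic_error:
  fixes F :: "'h::real_inner \<Rightarrow> real"
  assumes "\<And>m. \<bar>F m - F l - (m - l) \<bullet> D\<bar> \<le> C * (norm (m - l))\<^sup>2"
  shows "GDERIV F l :> D"
  unfolding gderiv_def has_derivative_def
proof
  show "bounded_linear (\<lambda>h. h \<bullet> D)" by (rule bounded_linear_inner_left)
  have "((\<lambda>m. (F m - F l - (m - l) \<bullet> D) /\<^sub>R norm (m - l)) \<longlongrightarrow> 0) (at l)"
  proof (rule Lim_null_comparison)
    show "\<forall>\<^sub>F m in at l. norm ((F m - F l - (m - l) \<bullet> D) /\<^sub>R norm (m - l)) \<le> C * norm (m - l)"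
      using assms by (auto simp: eventually_at_filter power2_eq_square field_simps)
    show "((\<lambda>m. C * norm (m - l)) \<longlongrightarrow> 0) (at l)"
      by (rule tendsto_eq_intros refl | simp)+
  qed
  \<comment> \<open>\<open>has_derivative_def\<close> expresses the base point as a
    \<open>Lim\<close>, which is \<open>l\<close> unless \<open>at l\<close> is trivial; then every
    limit statement holds.\<close>
  then show "((\<lambda>y. (F y - F (Lim (at l) (\<lambda>x. x)) - (y - Lim (at l) (\<lambda>x. x)) \<bullet> D)
      /\<^sub>R norm (y - Lim (at l) (\<lambda>x. x))) \<longlongrightarrow> 0) (at l)"
    by (cases "at l = bot") (simp_all add: Lim_ident_at)
qed

text \<open>Finite dimension of E enters as boundedness of \<open>A\<close>, which makes
  \<open>onorm A\<close> a genuine bound.\<close>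

locale strongly_convex_dual =
  fixes f :: "'e::real_normed_vector \<Rightarrow> real"
    and A :: "'e \<Rightarrow> 'h::real_inner"
    and b :: 'h and Q :: "'e set" and \<gamma> :: real
  assumes bounded_linear_A: "bounded_linear A"
    and strongly_convex: "strongly_convex_on \<gamma> Q f"
    and max_attained: "\<And>l. \<exists>x. is_arg_max (inner_objective f A l) (\<lambda>x. x \<in> Q) x"
begin

abbreviation "\<phi> \<equiv> dual_objective f A b Q"
abbreviation "xdual \<equiv> dual_point f A Q"
abbreviation "grad \<equiv> gradient \<phi>"
abbreviation "\<kappa> \<equiv> (onorm A)\<^sup>2 / \<gamma>"

lemma gamma_pos: "\<gamma> > 0"
  and convex_f: "convex_on Q f"
  using strongly_convex by (auto simp: strongly_convex_on_def)

lemma linear_A: "linear A"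
  using bounded_linear_A by (rule bounded_linear.linear)

lemmas A_add = linear_add[OF linear_A]
  and A_diff = linear_diff[OF linear_A]
  and A_scale = linear_scale[OF linear_A]

lemma dual_point_in_Q: "xdual l \<in> Q"
  and dual_point_maximal: "y \<in> Q \<Longrightarrow> inner_objective f A l y \<le> inner_objective f A l (xdual l)"
proof -
  have *: "is_arg_max (inner_objective f A l) (\<lambda>x. x \<in> Q) (xdual l)"
    unfolding dual_point_def arg_max_on_def arg_max_def using max_attained by (rule someI_ex)
  then show "xdual l \<in> Q" by (simp add: is_arg_max_def)
  show "y \<in> Q \<Longrightarrow> inner_objective f A l y \<le> inner_objective f A l (xdual l)"
    using * by (auto simp: is_arg_max_def not_less)
qed

text \<open>The quadratic term of strong convexity enters here. It yields the smoothness of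
  \<open>\<phi>\<close>, the identification of the primal solution and the final distance
  bound.\<close>

lemma dual_point_quadratic_growth:
  assumes "y \<in> Q"
  shows "f (xdual l) - l \<bullet> A (y - xdual l) + \<gamma> / 2 * (norm (xdual l - y))\<^sup>2 \<le> f y"
proof -
  have "linear (\<lambda>v. - (l \<bullet> A v))"
    by (rule linearI) (simp_all add: A_add A_scale inner_add_right)
  moreover have "f (xdual l) - l \<bullet> A (z - xdual l) \<le> f z" if "z \<in> Q" for z
    using dual_point_maximal[OF that, of l] by (simp add: inner_objective_def A_diff inner_diff_right)
  ultimately have "subgradient_on Q f (xdual l) (\<lambda>v. - (l \<bullet> A v))"
    by (simp add: subgradient_on_def)
  with strongly_convex dual_point_in_Q[of l] assms show ?thesis
    unfolding strongly_convex_on_def by fastforce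
qed

lemma dual_objective_eq: "\<phi> l = l \<bullet> (b - A (xdual l)) - f (xdual l)"
proof -
  have "(SUP x\<in>Q. inner_objective f A l x) = inner_objective f A l (xdual l)"
    by (rule cSup_eq_maximum) (auto simp: dual_point_in_Q dual_point_maximal)
  then show ?thesis by (simp add: dual_objective_def inner_objective_def inner_diff_right)
qed

lemma dual_objective_ge:
  assumes "y \<in> Q"
  shows "l \<bullet> (b - A y) - f y \<le> \<phi> l"
  using dual_point_maximal[OF assms, of l]
  by (simp add: dual_objective_eq inner_objective_def inner_diff_right)

text \<open>The maximiser for \<open>l\<close> is a candidate in the inner problem for
  \<open>m\<close>, and its value is affine in the multiplier with slope
  \<open>b - A (xdual l)\<close>.\<close>

lemma dual_linear_lower: "\<phi> l + (m - l) \<bullet> (b - A (xdual l)) \<le> \<phi> m"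
  using dual_objective_ge[OF dual_point_in_Q, of m l]
  by (simp add: dual_objective_eq[of l] inner_diff_left)

lemma dual_quadratic_upper:
  "\<phi> m \<le> \<phi> l + (m - l) \<bullet> (b - A (xdual l)) + \<kappa> / 2 * (norm (m - l))\<^sup>2"
proof -
  define d where "d = norm (xdual l - xdual m)"
  \<comment> \<open>Quadratic growth at \<open>xdual l\<close>, tested at
    \<open>xdual m\<close>.\<close>
  have "\<phi> m \<le> \<phi> l + (m - l) \<bullet> (b - A (xdual l)) + (m - l) \<bullet> A (xdual l - xdual m) - \<gamma> / 2 * d\<^sup>2"
    using dual_point_quadratic_growth[OF dual_point_in_Q, of l m]
    by (simp add: dual_objective_eq[of l] dual_objective_eq[of m] d_def A_diff inner_diff_left
        inner_diff_right)
  moreover have "(m - l) \<bullet> A (xdual l - xdual m) \<le> norm (m - l) * (onorm A * d)"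
    using onorm_inner_le[OF bounded_linear_A, of "m - l" "xdual l - xdual m"] by (simp add: d_def)
  moreover have "norm (m - l) * (onorm A * d) - \<gamma> / 2 * d\<^sup>2 \<le> \<kappa> / 2 * (norm (m - l))\<^sup>2"
  proof -
    \<comment> \<open>Young's inequality: the square is completed in \<open>d\<close>, whose worst
      value is \<open>norm (m - l) * onorm A / \<gamma>\<close>.\<close>
    have "0 \<le> (norm (m - l) * onorm A - \<gamma> * d)\<^sup>2 / (2 * \<gamma>)" using gamma_pos by simp
    also have "\<dots> = \<kappa> / 2 * (norm (m - l))\<^sup>2 - (norm (m - l) * (onorm A * d) - \<gamma> / 2 * d\<^sup>2)"
      using gamma_pos by (simp add: power2_eq_square field_simps)
    finally show ?thesis by simp
  qed
  ultimately show ?thesis by linarith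
qed

lemma dual_GDERIV: "GDERIV \<phi> l :> b - A (xdual l)"
proof (rule GDERIV_if_quadratic_error)
  show "\<bar>\<phi> m - \<phi> l - (m - l) \<bullet> (b - A (xdual l))\<bar> \<le> \<kappa> / 2 * (norm (m - l))\<^sup>2" for m
    using dual_linear_lower[of l m] dual_quadratic_upper[of m l] by linarith
qed

lemma grad_eq: "grad l = b - A (xdual l)"
  using dual_GDERIV by (rule gradient_eq)

section \<open>Optimality conditions and duality\<close>

lemma dual_solution_residual:
  assumes "dual_solution f A b Q l"
  shows "A (xdual l) = b"
proof -
  have "(\<lambda>h. h \<bullet> (b - A (xdual l))) = (\<lambda>h. 0)"
    using dual_GDERIV[of l] assms
    by (intro has_derivative_local_min[of \<phi> _ l])
      (auto simp: gderiv_def dual_solution_def is_arg_min_def not_less)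
  then have "(b - A (xdual l)) \<bullet> (b - A (xdual l)) = 0" by meson
  then show ?thesis by simp
qed

lemma primal_value_eq:
  assumes "is_arg_min f (\<lambda>x. x \<in> feasible A b Q) xstar"
  shows "primal_value f A b Q = f xstar"
  unfolding primal_value_def using assms
  by (intro cInf_eq_minimum) (auto simp: is_arg_min_def not_less)

lemma weak_duality:
  assumes "x \<in> feasible A b Q"
  shows "- f x \<le> \<phi> l"
  using dual_objective_ge[of x l] assms by (simp add: feasible_def)

text \<open>Growth at \<open>xdual l\<close> is tested at \<open>xstar\<close>: both points satisfy
  the constraint, so the linear term vanishes, and optimality of \<open>xstar\<close> leaves no room
  for a positive distance.\<close>

lemma primal_solution_eq_dual_point:
  assumes "dual_solution f A b Q l" "is_arg_min f (\<lambda>x. x \<in> feasible A b Q) xstar"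
  shows "xdual l = xstar"
proof -
  have feas: "xdual l \<in> feasible A b Q"
    using dual_solution_residual[OF assms(1)] by (simp add: feasible_def dual_point_in_Q)
  then have le: "f xstar \<le> f (xdual l)" using assms(2) by (auto simp: is_arg_min_def not_less)
  have xs: "xstar \<in> Q" "A xstar = b" using assms(2) by (auto simp: is_arg_min_def feasible_def)
  have "\<gamma> / 2 * (norm (xdual l - xstar))\<^sup>2 \<le> 0"
    using dual_point_quadratic_growth[OF xs(1), of l] le xs(2) dual_solution_residual[OF assms(1)]
    by (simp add: A_diff)
  then show ?thesis using gamma_pos by (simp add: mult_le_0_iff)
qed

end

section \<open>One iteration of the method\<close>

text \<open>Justifies the \<open>THE\<close> in the definition of the step size.\<close>

lemma step_size_ex1:
  fixes M \<beta> :: real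
  assumes "M > 0" "\<beta> \<ge> 0"
  shows "\<exists>!a. a > 0 \<and> \<beta> + a = M * a\<^sup>2"
proof
  define r where "r = sqrt (1 + 4 * M * \<beta>)"
  define a where "a = (1 + r) / (2 * M)"
  have r: "r\<^sup>2 = 1 + 4 * M * \<beta>" "r \<ge> 0" using assms by (simp_all add: r_def)
  have "M * a\<^sup>2 = (1 + 2 * r + r\<^sup>2) / (4 * M)"
    using assms by (simp add: a_def power2_eq_square field_simps)
  also have "\<dots> = \<beta> + a" using assms unfolding r(1) by (simp add: a_def field_simps)
  finally show "a > 0 \<and> \<beta> + a = M * a\<^sup>2" using assms r by (simp add: a_def)
  fix c assume c: "c > 0 \<and> \<beta> + c = M * c\<^sup>2"
  \<comment> \<open>Subtracting the two equations factors out \<open>c - a\<close>. The other factor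
    is positive because \<open>M * c \<ge> 1\<close> and \<open>M * a \<ge> 1 / 2\<close>.\<close>
  have "(c - a) * (M * (c + a) - 1) = 0"
    using c \<open>M * a\<^sup>2 = (1 + 2 * r + r\<^sup>2) / (4 * M)\<close> \<open>_ = \<beta> + a\<close>
    by (simp add: algebra_simps power2_eq_square)
  moreover have "M * (c + a) - 1 > 0"
  proof -
    have "M * a = (1 + r) / 2" using assms by (simp add: a_def)
    moreover have "M * c \<ge> 1"
    proof -
      have "1 * c \<le> \<beta> + c" using assms by simp
      also have "\<dots> = (M * c) * c" using c by (simp add: power2_eq_square)
      finally have "1 * c \<le> (M * c) * c" .
      then show ?thesis using c mult_le_cancel_right_pos[of c 1 "M * c"] by blast
    qed
    ultimately show ?thesis using r by (simp add: algebra_simps)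
  qed
  ultimately show "c = a" by simp
qed

text \<open>With \<open>s = sqrt (\<beta> + a)\<close> the step equation reads
  \<open>\<beta> = s\<^sup>2 - s / sqrt M\<close>, which is \<open>1 / (4 * M)\<close> short of a
  perfect square. Linear growth of the root makes \<open>\<beta>\<close> grow quadratically.\<close>

lemma sqrt_step_growth:
  fixes M \<beta> a :: real
  assumes "M > 0" "\<beta> \<ge> 0" "a > 0" "\<beta> + a = M * a\<^sup>2"
  shows "sqrt \<beta> + 1 / (2 * sqrt M) \<le> sqrt (\<beta> + a)"
proof -
  define s where "s = sqrt (\<beta> + a)"
  have s: "s > 0" "s\<^sup>2 = \<beta> + a" "s = sqrt M * a"
    unfolding s_def using assms(2,3) by simp_all (use assms in \<open>simp add: real_sqrt_mult\<close>)
  have "\<beta> = s\<^sup>2 - s / sqrt M" using assms s by simp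
  also have "\<dots> \<le> (s - 1 / (2 * sqrt M))\<^sup>2" by (simp add: power2_eq_square algebra_simps)
  finally have "sqrt \<beta> \<le> \<bar>s - 1 / (2 * sqrt M)\<bar>"
    using real_sqrt_le_mono by fastforce
  moreover have "s \<ge> 1 / (2 * sqrt M)"
  proof -
    have "s / sqrt M \<le> s * s" using \<open>\<beta> = s\<^sup>2 - s / sqrt M\<close> assms(2) by (simp add: power2_eq_square)
    then have "s * (1 / sqrt M) \<le> s * s" by simp
    then have "1 / sqrt M \<le> s" using s(1) by (simp only: mult_le_cancel_left_pos)
    moreover have "1 / (2 * sqrt M) \<le> 1 / sqrt M" using assms(1) by (simp add: field_simps)
    ultimately show ?thesis by linarith
  qed
  ultimately show ?thesis by (simp add: s_def)
qed

context strongly_convex_dual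
begin

abbreviation "trial \<equiv> apdagd_trial f A b Q"
abbreviation "accept \<equiv> apdagd_accept f A b Q"
abbreviation "iterate \<equiv> apdagd f A b Q"

text \<open>The loop invariant. Let \<open>\<psi>\<close> be half the squared norm plus the
  linearisations of \<open>\<phi>\<close> at the past \<open>\<lambda>\<close>, weighted by the step
  sizes. Then \<open>\<zeta>\<close> minimises \<open>\<psi>\<close>, and the last line is the bound
  of \<open>\<beta> * \<phi> \<eta>\<close> by the minimum, with Jensen's inequality replacing
  averaged values of \<open>f\<close> by \<open>f\<close> at the average. Membership in
  \<open>Q\<close> is conditional since the initial point 0 may lie outside.\<close>

definition estimate :: "('e, 'h) apdagd_state \<Rightarrow> bool" where
  "estimate s \<longleftrightarrow>
     st_M s > 0 \<and> st_beta s \<ge> 0 \<and> (st_beta s > 0 \<longrightarrow> st_xhat s \<in> Q) \<and>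
     st_zeta s = st_beta s *\<^sub>R (A (st_xhat s) - b) \<and>
     st_beta s * (\<phi> (st_eta s) + f (st_xhat s)) \<le> - (norm (st_zeta s))\<^sup>2 / 2"

lemma trial_step_size:
  assumes "st_M s > 0" "st_beta s \<ge> 0"
  obtains a where "a > 0" "st_beta (trial s i) = st_beta s + a"
    "st_beta s + a = st_M (trial s i) * a\<^sup>2"
    "trial s i = (let M = 2 powi (int i - 1) * st_M s; \<beta>' = st_beta s + a; \<tau> = a / \<beta>';
         lam' = \<tau> *\<^sub>R st_zeta s + (1 - \<tau>) *\<^sub>R st_eta s;
         \<zeta>' = st_zeta s - a *\<^sub>R (b - A (xdual lam'));
         \<eta>' = \<tau> *\<^sub>R \<zeta>' + (1 - \<tau>) *\<^sub>R st_eta s;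
         x' = \<tau> *\<^sub>R xdual lam' + (1 - \<tau>) *\<^sub>R st_xhat s
     in \<lparr>st_M = M, st_beta = \<beta>', st_zeta = \<zeta>', st_eta = \<eta>', st_lam = lam', st_xhat = x'\<rparr>)"
proof -
  define M where "M = 2 powi (int i - 1) * st_M s"
  define a where "a = (THE a. a > 0 \<and> st_beta s + a = M * a\<^sup>2)"
  have "M > 0" using assms by (simp add: M_def)
  then have "a > 0 \<and> st_beta s + a = M * a\<^sup>2"
    unfolding a_def by (rule theI'[OF step_size_ex1]) (use assms in simp)
  then show thesis
    by (intro that[of a])
      (simp_all add: apdagd_trial_def Let_def grad_eq M_def[symmetric] a_def[symmetric])
qed

lemma st_M_trial: "st_M (trial s i) = 2 powi (int i - 1) * st_M s"
  by (simp add: apdagd_trial_def Let_def)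

section \<open>Termination of the line search and size of the accepted constant\<close>

lemma accept_if_M_ge:
  assumes "\<kappa> \<le> st_M s"
  shows "accept s"
proof -
  have "\<kappa> / 2 * (norm (st_eta s - st_lam s))\<^sup>2 \<le> st_M s / 2 * (norm (st_eta s - st_lam s))\<^sup>2"
    using assms by (intro mult_right_mono) auto
  with dual_quadratic_upper[of "st_eta s" "st_lam s"] show ?thesis
    by (simp add: apdagd_accept_def grad_eq inner_commute)
qed

lemma line_search_ends_if_M_pos:
  assumes "st_M s > 0"
  shows "line_search_ends f A b Q s"
proof -
  obtain n :: nat where n: "\<kappa> / st_M s < 2 ^ n" using real_arch_pow[of 2] by auto
  \<comment> \<open>Trial \<open>i\<close> scales by 2 to the power \<open>i - 1\<close>, so the
    factor \<open>2 ^ n\<close> occurs at trial \<open>Suc n\<close>.\<close>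
  have "\<kappa> \<le> st_M (trial s (Suc n))"
    using n assms by (simp add: st_M_trial pos_divide_less_eq mult.commute del: divide_divide_eq_left)
  then show ?thesis unfolding line_search_ends_def using accept_if_M_ge by blast
qed

lemma step_accept:
  assumes "st_M s > 0"
  shows "accept (apdagd_step f A b Q s)"
  using line_search_ends_if_M_pos[OF assms]
  unfolding line_search_ends_def apdagd_step_def by (rule LeastI_ex)

text \<open>Either the first trial is accepted and M is halved, or the preceding trial was rejected,
  so its constant was below \<open>\<kappa>\<close> and the accepted one is its double.\<close>

lemma step_M_le:
  assumes "0 < st_M s" "st_M s \<le> 2 * \<kappa>"
  shows "st_M (apdagd_step f A b Q s) \<le> 2 * \<kappa>"
proof -
  define i where "i = (LEAST i. accept (trial s i))"
  show ?thesis
  proof (cases i)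
    case 0
    then have "st_M (apdagd_step f A b Q s) = st_M s / 2"
      by (simp add: apdagd_step_def i_def[symmetric] st_M_trial)
    then show ?thesis using assms by simp
  next
    case (Suc j)
    then have "\<not> accept (trial s j)" using not_less_Least[of j "\<lambda>i. accept (trial s i)"] i_def by simp
    then have "st_M (trial s j) < \<kappa>" using accept_if_M_ge by force
    moreover have "st_M (trial s i) = 2 * st_M (trial s j)"
      by (simp add: st_M_trial Suc power_int_diff)
    ultimately show ?thesis by (simp add: apdagd_step_def i_def[symmetric])
  qed
qed

text \<open>The acceptance inequality, multiplied by \<open>\<beta>'\<close>, splits into a
  linearisation at the old \<open>\<eta>\<close>, bounded by \<open>\<phi> \<eta>\<close>, a
  linearisation at \<open>\<zeta>'\<close>, and a quadratic term that cancels the cross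
  terms.\<close>

lemma estimate_trial:
  assumes est: "estimate s" and acc: "accept (trial s i)"
  shows "estimate (trial s i)"
proof -
  define M \<beta> \<zeta> \<eta> x where "M = st_M (trial s i)" and "\<beta> = st_beta s" and "\<zeta> = st_zeta s"
    and "\<eta> = st_eta s" and "x = st_xhat s"
  have s: "st_M s > 0" "\<beta> \<ge> 0" "\<beta> > 0 \<Longrightarrow> x \<in> Q" "\<zeta> = \<beta> *\<^sub>R (A x - b)"
    "\<beta> * (\<phi> \<eta> + f x) \<le> - (norm \<zeta>)\<^sup>2 / 2"
    using est by (auto simp: estimate_def M_def \<beta>_def \<zeta>_def \<eta>_def x_def)
  obtain a where a: "a > 0" and Ma: "\<beta> + a = M * a\<^sup>2" and tr: "trial s i =
    (let M = 2 powi (int i - 1) * st_M s; \<beta>' = st_beta s + a; \<tau> = a / \<beta>';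
         lam' = \<tau> *\<^sub>R st_zeta s + (1 - \<tau>) *\<^sub>R st_eta s;
         \<zeta>' = st_zeta s - a *\<^sub>R (b - A (xdual lam'));
         \<eta>' = \<tau> *\<^sub>R \<zeta>' + (1 - \<tau>) *\<^sub>R st_eta s;
         x' = \<tau> *\<^sub>R xdual lam' + (1 - \<tau>) *\<^sub>R st_xhat s
     in \<lparr>st_M = M, st_beta = \<beta>', st_zeta = \<zeta>', st_eta = \<eta>', st_lam = lam', st_xhat = x'\<rparr>)"
    using trial_step_size[of s i] s(1,2) unfolding \<beta>_def M_def by metis
  define \<beta>' \<tau> where "\<beta>' = \<beta> + a" and "\<tau> = a / \<beta>'"
  define lam where "lam = \<tau> *\<^sub>R \<zeta> + (1 - \<tau>) *\<^sub>R \<eta>"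
  define y where "y = xdual lam"
  define g where "g = b - A y"
  define \<zeta>' where "\<zeta>' = \<zeta> - a *\<^sub>R g"
  define \<eta>' where "\<eta>' = \<tau> *\<^sub>R \<zeta>' + (1 - \<tau>) *\<^sub>R \<eta>"
  define x' where "x' = \<tau> *\<^sub>R y + (1 - \<tau>) *\<^sub>R x"
  have t: "trial s i = \<lparr>st_M = M, st_beta = \<beta>', st_zeta = \<zeta>', st_eta = \<eta>', st_lam = lam, st_xhat = x'\<rparr>"
    unfolding M_def st_M_trial
    by (subst tr) (simp add: Let_def \<beta>'_def \<tau>_def \<zeta>'_def \<eta>'_def x'_def g_def y_def lam_def
        \<beta>_def \<zeta>_def \<eta>_def x_def)
  have M: "M > 0" using s(1) by (simp add: M_def st_M_trial)
  have b': "\<beta>' > 0" using a s(2) by (simp add: \<beta>'_def)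
  have bt: "\<beta>' * \<tau> = a" "\<beta>' * (1 - \<tau>) = \<beta>" using b' by (simp_all add: \<tau>_def \<beta>'_def field_simps)
  have tau: "0 \<le> \<tau>" "\<tau> \<le> 1" using a s(2) by (simp_all add: \<tau>_def \<beta>'_def field_simps)
  \<comment> \<open>In the first iteration the old primal point gets weight 0, so it need not lie in
    \<open>Q\<close>.\<close>
  have tau1: "\<tau> = 1" if "\<beta> = 0" using that a by (simp add: \<tau>_def \<beta>'_def)
  have y: "y \<in> Q" by (simp add: y_def dual_point_in_Q)
  have "convex Q" using convex_f by (rule convex_on_imp_convex)
  have x': "x' \<in> Q \<and> f x' \<le> \<tau> * f y + (1 - \<tau>) * f x"
  proof (cases "\<beta> = 0")
    case True
    then show ?thesis using y by (simp add: x'_def tau1)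
  next
    case False
    with s have x: "x \<in> Q" by simp
    with y \<open>convex Q\<close> tau have "x' \<in> Q" by (simp add: x'_def convex_def)
    moreover have "f x' \<le> \<tau> * f y + (1 - \<tau>) * f x"
      using convex_onD[OF convex_f tau x y] by (simp add: x'_def add.commute)
    ultimately show ?thesis by simp
  qed
  have "\<beta>' * f x' \<le> \<beta>' * (\<tau> * f y + (1 - \<tau>) * f x)" using x' b' by (intro mult_left_mono) auto
  also have "\<dots> = (\<beta>' * \<tau>) * f y + (\<beta>' * (1 - \<tau>)) * f x" by (simp add: algebra_simps)
  finally have fx': "\<beta>' * f x' \<le> a * f y + \<beta> * f x" by (simp only: bt)
  have bx': "\<beta>' *\<^sub>R x' = a *\<^sub>R y + \<beta> *\<^sub>R x"
    by (simp only: x'_def scaleR_add_right scaleR_scaleR bt)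
  have b\<eta>': "\<beta>' *\<^sub>R \<eta>' = a *\<^sub>R \<zeta>' + \<beta> *\<^sub>R \<eta>"
    by (simp only: \<eta>'_def scaleR_add_right scaleR_scaleR bt)
  have z': "\<zeta>' = \<beta>' *\<^sub>R (A x' - b)"
  proof -
    have "\<beta>' *\<^sub>R (A x' - b) = A (\<beta>' *\<^sub>R x') - \<beta>' *\<^sub>R b" by (simp add: A_scale scaleR_diff_right)
    also have "A (\<beta>' *\<^sub>R x') = a *\<^sub>R A y + \<beta> *\<^sub>R A x" by (simp only: bx' A_add A_scale)
    also have "a *\<^sub>R A y + \<beta> *\<^sub>R A x - \<beta>' *\<^sub>R b = \<zeta>'"
      by (simp add: \<zeta>'_def g_def s(4) \<beta>'_def algebra_simps)
    finally show ?thesis by simp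
  qed
  have phi_lam: "\<phi> lam = lam \<bullet> g - f y" by (simp add: dual_objective_eq g_def y_def)
  have lower: "\<phi> lam + (\<eta> - lam) \<bullet> g \<le> \<phi> \<eta>" unfolding g_def y_def by (rule dual_linear_lower)
  \<comment> \<open>Both points contain the same multiple of \<open>\<eta>\<close>, which
    cancels.\<close>
  have eta_lam: "\<eta>' - lam = \<tau> *\<^sub>R (\<zeta>' - \<zeta>)" by (simp add: \<eta>'_def lam_def algebra_simps)
  have "\<phi> \<eta>' \<le> \<phi> lam + g \<bullet> (\<eta>' - lam) + M / 2 * (norm (\<eta>' - lam))\<^sup>2"
    using acc by (simp add: t apdagd_accept_def grad_eq g_def y_def)
  then have "\<beta>' * \<phi> \<eta>' \<le> \<beta>' * (\<phi> lam + g \<bullet> (\<eta>' - lam) + M / 2 * (norm (\<eta>' - lam))\<^sup>2)"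
    using b' by (intro mult_left_mono) auto
  also have "\<dots> = \<beta>' * \<phi> lam + g \<bullet> (\<beta>' *\<^sub>R \<eta>' - \<beta>' *\<^sub>R lam) + \<beta>' * (M / 2 * (norm (\<eta>' - lam))\<^sup>2)"
    by (simp add: algebra_simps inner_diff_right)
  also have "\<beta>' * (M / 2 * (norm (\<eta>' - lam))\<^sup>2) = (norm (\<zeta>' - \<zeta>))\<^sup>2 / 2"
  proof -
    \<comment> \<open>The step size equation is chosen for this: it says
      \<open>\<beta>' * M * \<tau>\<^sup>2 = 1\<close>, so the quadratic term has factor exactly one
      half.\<close>
    have "\<beta>' * (M * \<tau>\<^sup>2) = M * a\<^sup>2 / \<beta>'" using b' by (simp add: \<tau>_def power2_eq_square)
    also have "\<dots> = 1" using b' by (simp add: \<beta>'_def flip: Ma)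
    finally have "\<beta>' * (M * \<tau>\<^sup>2) = 1" .
    moreover have "\<beta>' * (M / 2 * (norm (\<eta>' - lam))\<^sup>2) = \<beta>' * (M * \<tau>\<^sup>2) * (norm (\<zeta>' - \<zeta>))\<^sup>2 / 2"
      by (simp add: eta_lam power_mult_distrib)
    ultimately show ?thesis by simp
  qed
  also have "\<beta>' * \<phi> lam + g \<bullet> (\<beta>' *\<^sub>R \<eta>' - \<beta>' *\<^sub>R lam)
      = \<beta> * (\<phi> lam + (\<eta> - lam) \<bullet> g) + a * (\<phi> lam + (\<zeta>' - lam) \<bullet> g)"
    unfolding b\<eta>' by (simp add: \<beta>'_def inner_diff_right inner_add_right inner_commute algebra_simps)
  also have "\<phi> lam + (\<zeta>' - lam) \<bullet> g = \<zeta>' \<bullet> g - f y" by (simp add: phi_lam inner_diff_left)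
  finally have "\<beta>' * \<phi> \<eta>' \<le> \<beta> * (\<phi> lam + (\<eta> - lam) \<bullet> g) + a * (\<zeta>' \<bullet> g - f y)
      + (norm (\<zeta>' - \<zeta>))\<^sup>2 / 2" .
  moreover have "\<beta> * (\<phi> lam + (\<eta> - lam) \<bullet> g) \<le> \<beta> * \<phi> \<eta>"
    using lower s(2) by (intro mult_left_mono)
  moreover have "a * (\<zeta>' \<bullet> g) = \<zeta>' \<bullet> \<zeta> - (norm \<zeta>')\<^sup>2"
  proof -
    have "a * (\<zeta>' \<bullet> g) = \<zeta>' \<bullet> (a *\<^sub>R g)" by simp
    also have "a *\<^sub>R g = \<zeta> - \<zeta>'" by (simp add: \<zeta>'_def)
    finally show ?thesis by (simp add: inner_diff_right power2_norm_eq_inner)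
  qed
  moreover have "(norm (\<zeta>' - \<zeta>))\<^sup>2 = (norm \<zeta>')\<^sup>2 - 2 * (\<zeta>' \<bullet> \<zeta>) + (norm \<zeta>)\<^sup>2"
    by (simp add: power2_norm_eq_inner inner_diff_left inner_diff_right inner_commute)
  \<comment> \<open>The products \<open>\<zeta>' \<bullet> \<zeta>\<close> cancel, and the old
    invariant absorbs half the squared norm of \<open>\<zeta>\<close>.\<close>
  ultimately have "\<beta>' * (\<phi> \<eta>' + f x') \<le> - (norm \<zeta>')\<^sup>2 / 2"
    using s(5) fx' unfolding distrib_left right_diff_distrib by argo
  then show ?thesis using M b' x' z' by (simp add: estimate_def t)
qed

section \<open>The convergence rate\<close>

text \<open>The three claims are carried together: the invariant gives \<open>M > 0\<close>, and
  \<open>M \<le> 2 * \<kappa>\<close> makes each step add at least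
  \<open>1 / (2 * sqrt (2 * \<kappa>))\<close> to the root of \<open>\<beta>\<close>.\<close>

lemma estimate_iterate:
  assumes "0 < L0" "L0 \<le> 2 * \<kappa>"
  shows "estimate (iterate L0 k) \<and> st_M (iterate L0 k) \<le> 2 * \<kappa> \<and>
    real k / (2 * sqrt (2 * \<kappa>)) \<le> sqrt (st_beta (iterate L0 k))"
proof (induction k)
  case 0
  show ?case using assms by (simp add: apdagd_def apdagd_init_def estimate_def)
next
  case (Suc k)
  define s where "s = iterate L0 k"
  have step: "iterate L0 (Suc k) = apdagd_step f A b Q s" by (simp add: apdagd_def s_def)
  have IH: "estimate s" "st_M s \<le> 2 * \<kappa>" "real k / (2 * sqrt (2 * \<kappa>)) \<le> sqrt (st_beta s)"
    using Suc by (auto simp: s_def)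
  then have Mb: "0 < st_M s" "0 \<le> st_beta s" by (auto simp: estimate_def)
  define i where "i = (LEAST i. accept (trial s i))"
  have step_trial: "apdagd_step f A b Q s = trial s i" by (simp add: apdagd_step_def i_def)
  have est: "estimate (trial s i)"
    using estimate_trial[OF IH(1)] step_accept[OF Mb(1)] by (simp add: step_trial)
  have M: "st_M (trial s i) \<le> 2 * \<kappa>" using step_M_le[OF Mb(1) IH(2)] by (simp only: step_trial)
  have M': "0 < st_M (trial s i)" using est by (simp add: estimate_def)
  obtain a where a: "a > 0" "st_beta (trial s i) = st_beta s + a"
    "st_beta s + a = st_M (trial s i) * a\<^sup>2" using trial_step_size[OF Mb] by metis
  have "real (Suc k) / (2 * sqrt (2 * \<kappa>)) = real k / (2 * sqrt (2 * \<kappa>)) + 1 / (2 * sqrt (2 * \<kappa>))"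
    by (simp add: add_divide_distrib)
  also have "1 / (2 * sqrt (2 * \<kappa>)) \<le> 1 / (2 * sqrt (st_M (trial s i)))"
    using M M' by (intro divide_left_mono mult_left_mono real_sqrt_le_mono) auto
  also have "real k / (2 * sqrt (2 * \<kappa>)) + 1 / (2 * sqrt (st_M (trial s i)))
      \<le> sqrt (st_beta (trial s i))"
    using sqrt_step_growth[OF M' Mb(2) a(1,3)] IH(3) a(2) by simp
  finally show ?case using est M by (simp add: step step_trial)
qed

lemma beta_iterate_ge:
  assumes "0 < L0" "L0 \<le> 2 * \<kappa>"
  shows "(real k)\<^sup>2 / (8 * \<kappa>) \<le> st_beta (iterate L0 k)"
proof -
  have "(real k / (2 * sqrt (2 * \<kappa>)))\<^sup>2 \<le> (sqrt (st_beta (iterate L0 k)))\<^sup>2"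
    using estimate_iterate[OF assms, of k] assms by (intro power_mono) auto
  also have "\<dots> = st_beta (iterate L0 k)"
    using estimate_iterate[OF assms, of k] by (simp add: estimate_def)
  also have "(real k / (2 * sqrt (2 * \<kappa>)))\<^sup>2 = (real k)\<^sup>2 / (8 * \<kappa>)"
    using assms by (simp add: power_divide power_mult_distrib del: times_divide_eq_right)
  finally show ?thesis .
qed

section \<open>From the invariant to error bounds\<close>

lemma estimate_primal_dual_gap:
  assumes "estimate s" "st_beta s > 0"
  shows "f (st_xhat s) + \<phi> (st_eta s) \<le> - (st_beta s / 2) * (norm (A (st_xhat s) - b))\<^sup>2"
proof -
  have "st_beta s * (\<phi> (st_eta s) + f (st_xhat s))
      \<le> st_beta s * (- (st_beta s / 2) * (norm (A (st_xhat s) - b))\<^sup>2)"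
    using assms
    by (auto simp: estimate_def power_mult_distrib power2_eq_square add.commute mult.assoc
        mult.left_commute[of "norm (A (st_xhat s) - b)"])
  then show ?thesis using assms(2) by (simp only: mult_le_cancel_left_pos add.commute)
qed

lemma estimate_primal_dual_nonpos:
  assumes "estimate s" "st_beta s > 0"
  shows "f (st_xhat s) + \<phi> (st_eta s) \<le> 0"
proof -
  have "- (st_beta s / 2) * (norm (A (st_xhat s) - b))\<^sup>2 \<le> 0" using assms(2) by simp
  with estimate_primal_dual_gap[OF assms] show ?thesis by linarith
qed

lemma estimate_residual_le:
  assumes "estimate s" "st_beta s > 0" "dual_solution f A b Q l" "norm l \<le> R"
  shows "norm (A (st_xhat s) - b) \<le> 2 * R / st_beta s"
proof -
  define x where "x = st_xhat s"
  define r where "r = norm (A x - b)"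
  have "x \<in> Q" using assms by (simp add: estimate_def x_def)
  have "\<phi> l \<le> \<phi> (st_eta s)" using assms(3) by (auto simp: dual_solution_def is_arg_min_def not_less)
  with dual_objective_ge[OF \<open>x \<in> Q\<close>, of l] estimate_primal_dual_gap[OF assms(1,2)]
  have "st_beta s / 2 * r\<^sup>2 \<le> - (l \<bullet> (b - A x))" by (simp add: r_def x_def)
  also have "\<dots> = l \<bullet> (A x - b)" by (simp add: inner_diff_right)
  also have "\<dots> \<le> norm l * r" unfolding r_def by (rule norm_cauchy_schwarz)
  also have "\<dots> \<le> R * r" using assms(4) by (intro mult_right_mono) (auto simp: r_def)
  finally have "r * (st_beta s * r) \<le> r * (2 * R)" by (simp add: power2_eq_square algebra_simps)
  moreover have "R \<ge> 0" using assms(4) norm_ge_zero[of l] by linarith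
  \<comment> \<open>For a positive residual one factor \<open>r\<close> cancels; for
    \<open>r = 0\<close> the claim is \<open>R \<ge> 0\<close>.\<close>
  ultimately have "st_beta s * r \<le> 2 * R"
    by (cases "r = 0") (auto simp: r_def mult_le_cancel_left_pos)
  then show ?thesis using assms(2) by (simp add: r_def x_def field_simps)
qed

text \<open>Quadratic growth is applied at \<open>xdual l = xstar\<close>. The gap is nonpositive,
  so only the multiplier term remains, at most \<open>R\<close> times the residual bound.\<close>

lemma estimate_distance_le:
  assumes "estimate s" "st_beta s > 0" "dual_solution f A b Q l" "norm l \<le> R"
    and "is_arg_min f (\<lambda>x. x \<in> feasible A b Q) xstar"
  shows "\<gamma> * (norm (st_xhat s - xstar))\<^sup>2 \<le> 4 * R\<^sup>2 / st_beta s"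
proof -
  define x where "x = st_xhat s"
  have x: "x \<in> Q" using assms by (simp add: estimate_def x_def)
  have xs: "xstar \<in> feasible A b Q" using assms(5) by (simp add: is_arg_min_def)
  have R: "R \<ge> 0" using assms(4) norm_ge_zero[of l] by linarith
  have "\<gamma> / 2 * (norm (xstar - x))\<^sup>2 \<le> f x - f xstar + l \<bullet> (A x - b)"
    using dual_point_quadratic_growth[OF x, of l] xs
    by (simp add: primal_solution_eq_dual_point[OF assms(3,5)] A_diff feasible_def)
  also have "f x - f xstar \<le> f x + \<phi> (st_eta s)" using weak_duality[OF xs, of "st_eta s"] by simp
  also have "\<dots> \<le> 0"
    using estimate_primal_dual_nonpos[OF assms(1,2)] by (simp add: x_def)
  also have "l \<bullet> (A x - b) \<le> norm l * norm (A x - b)" by (rule norm_cauchy_schwarz)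
  also have "\<dots> \<le> R * (2 * R / st_beta s)"
    unfolding x_def using assms(4) R by (intro mult_mono estimate_residual_le[OF assms(1-4)]) auto
  finally show ?thesis by (simp add: x_def power2_eq_square norm_minus_commute)
qed

lemma iterate_rate:
  assumes L0: "0 < L0" "L0 \<le> 2 * \<kappa>"
    and sol: "dual_solution f A b Q l" "norm l \<le> R"
    and arg: "is_arg_min f (\<lambda>x. x \<in> feasible A b Q) xstar" and k: "k \<ge> 1"
  shows "f (st_xhat (iterate L0 k)) + \<phi> (st_eta (iterate L0 k)) \<le> 0"
    and "norm (A (st_xhat (iterate L0 k)) - b) \<le> 16 * (onorm A)\<^sup>2 * R / (\<gamma> * (real k)\<^sup>2)"
    and "norm (st_xhat (iterate L0 k) - xstar) \<le> 8 / real k * (onorm A * R / \<gamma>)"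
proof -
  define s where "s = iterate L0 k"
  have est: "estimate s" using estimate_iterate[OF L0] by (simp add: s_def)
  \<comment> \<open>Positivity of \<open>\<kappa>\<close> comes from \<open>0 < L0\<close> and
    \<open>L0 \<le> 2 * \<kappa>\<close>.\<close>
  have kp: "0 < (real k)\<^sup>2 / (8 * \<kappa>)" using L0 k by (intro divide_pos_pos) auto
  moreover have ge: "(real k)\<^sup>2 / (8 * \<kappa>) \<le> st_beta s"
    using beta_iterate_ge[OF L0] by (simp add: s_def)
  ultimately have bp: "0 < st_beta s" by linarith
  have R: "R \<ge> 0" using sol(2) norm_ge_zero[of l] by linarith
  show "f (st_xhat (iterate L0 k)) + \<phi> (st_eta (iterate L0 k)) \<le> 0"
    using estimate_primal_dual_nonpos[OF est bp] by (simp add: s_def)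
  have "norm (A (st_xhat s) - b) \<le> 2 * R / st_beta s"
    by (rule estimate_residual_le[OF est bp sol])
  also have "\<dots> \<le> 2 * R / ((real k)\<^sup>2 / (8 * \<kappa>))"
    using R kp ge bp by (intro divide_left_mono mult_pos_pos) auto
  also have "\<dots> = 16 * (onorm A)\<^sup>2 * R / (\<gamma> * (real k)\<^sup>2)" by (simp add: mult_ac)
  finally show "norm (A (st_xhat (iterate L0 k)) - b) \<le> 16 * (onorm A)\<^sup>2 * R / (\<gamma> * (real k)\<^sup>2)"
    by (simp add: s_def)
  define D where "D = onorm A * R / (\<gamma> * real k)"
  have D: "D \<ge> 0" using R gamma_pos onorm_pos_le[OF bounded_linear_A] by (simp add: D_def)
  have "\<gamma> * (norm (st_xhat s - xstar))\<^sup>2 \<le> 4 * R\<^sup>2 / st_beta s"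
    by (rule estimate_distance_le[OF est bp sol arg])
  also have "\<dots> \<le> 4 * R\<^sup>2 / ((real k)\<^sup>2 / (8 * \<kappa>))"
    using kp ge bp by (intro divide_left_mono mult_pos_pos) auto
  also have "\<dots> = \<gamma> * (32 * D\<^sup>2)" using gamma_pos k by (simp add: D_def power2_eq_square mult_ac)
  finally have "(norm (st_xhat s - xstar))\<^sup>2 \<le> 32 * D\<^sup>2" using gamma_pos by simp
  \<comment> \<open>Since 32 is at most 64, the constant 8 of the claim suffices.\<close>
  also have "\<dots> \<le> (8 * D)\<^sup>2" by (simp add: power_mult_distrib)
  finally have "norm (st_xhat s - xstar) \<le> 8 * D" by (rule power2_le_imp_le) (use D in simp)
  then show "norm (st_xhat (iterate L0 k) - xstar) \<le> 8 / real k * (onorm A * R / \<gamma>)"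
    by (simp add: s_def D_def mult.commute)
qed

text \<open>The gap test holds from the first iteration on, the gap being nonpositive; the residual
  test holds once the quadratic decay reaches the tolerance.\<close>

lemma stopping_time_exists:
  assumes L0: "0 < L0" "L0 \<le> 2 * \<kappa>"
    and sol: "dual_solution f A b Q l" "norm l \<le> R"
    and arg: "is_arg_min f (\<lambda>x. x \<in> feasible A b Q) xstar"
    and "\<epsilon>f > 0" "\<epsilon>eq > 0"
  shows "\<exists>k. (\<forall>j\<le>k. line_search_ends f A b Q (iterate L0 j)) \<and>
    apdagd_stop f A b Q \<epsilon>f \<epsilon>eq (iterate L0 (Suc k))"
proof -
  define C where "C = 16 * (onorm A)\<^sup>2 * R / \<gamma>"
  obtain k :: nat where k: "C / \<epsilon>eq < real k" using reals_Archimedean2 by blast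
  have "real k \<le> (real (Suc k))\<^sup>2" by (simp add: power2_eq_square algebra_simps)
  then have "C \<le> \<epsilon>eq * (real (Suc k))\<^sup>2" using k \<open>\<epsilon>eq > 0\<close>
    by (smt (verit) mult.commute mult_left_mono pos_divide_less_eq)
  then have "C / (real (Suc k))\<^sup>2 \<le> \<epsilon>eq" by (subst pos_divide_le_eq) auto
  moreover have "norm (A (st_xhat (iterate L0 (Suc k))) - b) \<le> C / (real (Suc k))\<^sup>2"
    using iterate_rate(2)[OF L0 sol arg, of "Suc k"] by (simp add: C_def)
  moreover have "f (st_xhat (iterate L0 (Suc k))) + \<phi> (st_eta (iterate L0 (Suc k))) \<le> \<epsilon>f"
    using iterate_rate(1)[OF L0 sol arg, of "Suc k"] \<open>\<epsilon>f > 0\<close> by simp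
  ultimately have "apdagd_stop f A b Q \<epsilon>f \<epsilon>eq (iterate L0 (Suc k))"
    unfolding apdagd_stop_def by linarith
  moreover have "line_search_ends f A b Q (iterate L0 j)" for j
    using estimate_iterate[OF L0, of j] by (intro line_search_ends_if_M_pos) (simp add: estimate_def)
  ultimately show ?thesis by blast
qed

end

theorem theorem3p3:
  fixes f :: "'e::real_normed_vector \<Rightarrow> real"
    and A :: "'e \<Rightarrow> 'h::euclidean_space"
    and b :: 'h and Q :: "'e set"
    and \<gamma> L L0 R :: real
    and lamstar :: 'h and xstar :: 'e
  assumes "finite_dim TYPE('e)"
    and "closed Q" and "convex Q"
    and "linear A"
    and "strongly_convex_on \<gamma> Q f"
    and max_attained: "\<And>l. \<exists>x. is_arg_max (inner_objective f A l) (\<lambda>x. x \<in> Q) x"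
    and "L-lipschitz_on UNIV (gradient (dual_objective f A b Q))"
    and "L \<le> (onorm A)\<^sup>2 / \<gamma>"
    and "0 < L0" and "L0 < 2 * L"
    and "dual_solution f A b Q lamstar"
    and "\<And>l. dual_solution f A b Q l \<Longrightarrow> norm lamstar \<le> norm l"
    and "norm lamstar \<le> R"
    and "is_arg_min f (\<lambda>x. x \<in> feasible A b Q) xstar"
  shows "(\<forall>k\<ge>1.
        let xhat = st_xhat (apdagd f A b Q L0 k);
            \<eta> = st_eta (apdagd f A b Q L0 k)
        in f xhat - primal_value f A b Q \<le> f xhat + dual_objective f A b Q \<eta> \<and>
           f xhat + dual_objective f A b Q \<eta> \<le> 16 * (onorm A)\<^sup>2 * R\<^sup>2 / (\<gamma> * (real k)\<^sup>2) \<and>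
           norm (A xhat - b) \<le> 16 * (onorm A)\<^sup>2 * R / (\<gamma> * (real k)\<^sup>2) \<and>
           norm (xhat - xstar) \<le> 8 / real k * (onorm A * R / \<gamma>))
    \<and> (\<forall>\<epsilon>f>0. \<forall>\<epsilon>eq>0. \<exists>k.
        (\<forall>j\<le>k. line_search_ends f A b Q (apdagd f A b Q L0 j)) \<and>
        apdagd_stop f A b Q \<epsilon>f \<epsilon>eq (apdagd f A b Q L0 (Suc k)))"
proof -
  interpret strongly_convex_dual f A b Q \<gamma>
    using finite_dim_linear_imp_bounded_linear[OF assms(1) \<open>linear A\<close>] assms(5) max_attained
    by (simp add: strongly_convex_dual_def)
  \<comment> \<open>The initial constant obeys the same bound \<open>2 * \<kappa>\<close> that the
    line search preserves.\<close>
  have L0: "0 < L0" "L0 \<le> 2 * \<kappa>"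
    using \<open>0 < L0\<close> \<open>L0 < 2 * L\<close> \<open>L \<le> \<kappa>\<close> by linarith+
  note rate = iterate_rate[OF L0 \<open>dual_solution f A b Q lamstar\<close> \<open>norm lamstar \<le> R\<close> assms(14)]
  have "xstar \<in> feasible A b Q" using assms(14) by (simp add: is_arg_min_def)
  then have weak: "- primal_value f A b Q \<le> \<phi> l" for l
    using weak_duality by (simp add: primal_value_eq[OF assms(14)])
  have "f xhat - primal_value f A b Q \<le> f xhat + \<phi> l" for xhat l
    using weak[of l] by linarith
  \<comment> \<open>The right-hand side is nonnegative, so the nonpositive gap suffices.\<close>
  moreover have "f (st_xhat (iterate L0 k)) + \<phi> (st_eta (iterate L0 k))
      \<le> 16 * (onorm A)\<^sup>2 * R\<^sup>2 / (\<gamma> * (real k)\<^sup>2)" if "k \<ge> 1" for k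
    using rate(1)[OF that] by (rule order_trans) (use gamma_pos in simp)
  ultimately show ?thesis
    using rate(2,3) stopping_time_exists[OF L0 assms(11) assms(13) assms(14)]
    by (simp add: Let_def)
qed

end
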